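(* Let $X$ be a finite simple graph on $n$ vertices with at least one edge. Let $\Delta$ and $\delta$ denote the maximal and minimal vertex degrees of $X$, let $\lambda_{\max}$ be the largest Laplacian eigenvalue of $X$, let $\alpha$ be the independence number of $X$, and let $\alpha'$ be the independence number of the derived graph $X'$ of $X$. Then $$\alpha\leq n\Big(1-\frac{\Delta}{\lambda_{\max}}\Big)+\alpha'\,\frac{\Delta-\delta}{\lambda_{\max}-\delta}.$$
   Context: The Laplacian of a finite simple graph $X$ with vertex set $V$ is the linear operator $L$ on complex-valued functions on $V$ given by $(L\phi)(v)=\deg(v)\,\phi(v)-\sum_{w:\,w\sim v}\phi(w)$, where the sum is over the neighbours $w$ of $v$. The derived graph $X'$ of $X$ is the induced subgraph obtained from $X$ by deleting all vertices whose degree in $X$ is the maximal degree $\Delta$. If $X$ is regular, $X'$ has no vertices, and its independence number is $\alpha'=0$. The independence number of a graph is the maximum size of a set of pairwise non-adjacent vertices. *)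

theory Defs
  imports "HOL-Analysis.Analysis" "Graph_Theory.Digraph_Component"
begin

text \<open>
  A finite simple graph is a \<open>G\<close> with \<^term>\<open>graph G\<close>: a finite symmetric digraph
  without loops and without parallel arcs. Each edge \<open>{v, w}\<close> is represented by the two arcs
  from \<open>v\<close> to \<open>w\<close> and from \<open>w\<close> to \<open>v\<close>, so the degree of a vertex is its out-degree (equivalently
  its in-degree), and adjacency is the library's relation \<open>v \<rightarrow>\<^bsub>G\<^esub> w\<close>.
\<close>

definition max_degree :: "('a, 'b) pre_digraph \<Rightarrow> nat" where
  "max_degree G = Max (out_degree G ` verts G)"

definition min_degree :: "('a, 'b) pre_digraph \<Rightarrow> nat" where
  "min_degree G = Min (out_degree G ` verts G)"

definition independent_set :: "('a, 'b) pre_digraph \<Rightarrow> 'a set \<Rightarrow> bool" where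
  "independent_set G S \<longleftrightarrow> S \<subseteq> verts G \<and> (\<forall>v\<in>S. \<forall>w\<in>S. v \<noteq> w \<longrightarrow> \<not> v \<rightarrow>\<^bsub>G\<^esub> w)"

definition independence_number :: "('a, 'b) pre_digraph \<Rightarrow> nat" where
  "independence_number G = Max (card ` {S. independent_set G S})"

definition derived_graph :: "('a, 'b) pre_digraph \<Rightarrow> ('a, 'b) pre_digraph" where
  "derived_graph G = G \<restriction> (verts G - {v \<in> verts G. out_degree G v = max_degree G})"

definition laplacian :: "('a, 'b) pre_digraph \<Rightarrow> ('a \<Rightarrow> complex) \<Rightarrow> 'a \<Rightarrow> complex" where
  "laplacian G \<phi> v = of_nat (out_degree G v) * \<phi> v - (\<Sum>w | v \<rightarrow>\<^bsub>G\<^esub> w. \<phi> w)"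

text \<open>
  A function on the vertex set is represented by a function on the whole type of which only the
  values on \<^term>\<open>verts G\<close> are relevant; being non-zero and being equal are therefore required
  on \<^term>\<open>verts G\<close> only.
\<close>

definition laplacian_eigenvalue :: "('a, 'b) pre_digraph \<Rightarrow> complex \<Rightarrow> bool" where
  "laplacian_eigenvalue G \<mu> \<longleftrightarrow>
     (\<exists>\<phi>. (\<exists>v\<in>verts G. \<phi> v \<noteq> 0) \<and> (\<forall>v\<in>verts G. laplacian G \<phi> v = \<mu> * \<phi> v))"

text \<open>
  The maximum is taken over the real eigenvalues; by \<open>laplacian_eigenvalue_real\<close> below there are
  no others.
\<close>

definition lambda_max :: "('a, 'b) pre_digraph \<Rightarrow> real" where
  "lambda_max G = Max {x. laplacian_eigenvalue G (complex_of_real x)}"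

lemma laplacian_eigenvalue_real:
  assumes "graph G" and ev: "laplacian_eigenvalue G \<mu>"
  shows "\<mu> \<in> \<real>"
proof -
  interpret graph G by fact
  obtain \<phi> u where u: "u \<in> verts G" "\<phi> u \<noteq> 0"
    and eq: "\<And>v. v \<in> verts G \<Longrightarrow> laplacian G \<phi> v = \<mu> * \<phi> v"
    using ev unfolding laplacian_eigenvalue_def by blast
  let ?V = "verts G"
  define a :: "'a \<Rightarrow> 'a \<Rightarrow> complex" where "a v w = of_bool (v \<rightarrow>\<^bsub>G\<^esub> w)" for v w
  have sym: "a v w = a w v" for v w
    using sym_arcs by (auto simp: a_def symmetric_def dest: symD)
  have cnj_a: "cnj (a v w) = a v w" for v w by (simp add: a_def)
  have nb: "(\<Sum>w | v \<rightarrow>\<^bsub>G\<^esub> w. \<phi> w) = (\<Sum>w\<in>?V. a v w * \<phi> w)" for v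
    unfolding a_def
    by (rule sum.mono_neutral_cong_left) (auto simp: arcs_ends_conv)
  define A where "A = (\<Sum>v\<in>?V. \<Sum>w\<in>?V. a v w * (cnj (\<phi> v) * \<phi> w))"
  define D :: complex where "D = (\<Sum>v\<in>?V. of_nat (out_degree G v) * (cnj (\<phi> v) * \<phi> v))"
  define N :: complex where "N = (\<Sum>v\<in>?V. cnj (\<phi> v) * \<phi> v)"
  have "cnj A = (\<Sum>v\<in>?V. \<Sum>w\<in>?V. a v w * (cnj (\<phi> w) * \<phi> v))"
    unfolding A_def by (simp add: cnj_a mult_ac)
  also have "\<dots> = (\<Sum>w\<in>?V. \<Sum>v\<in>?V. a v w * (cnj (\<phi> w) * \<phi> v))"
    by (rule sum.swap)
  also have "\<dots> = A"
    unfolding A_def using sym by (intro sum.cong refl) metis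
  finally have A: "cnj A = A" .
  have D: "cnj D = D" unfolding D_def by (simp add: mult_ac)
  have N: "cnj N = N" unfolding N_def by (simp add: mult_ac)
  have "N = complex_of_real (\<Sum>v\<in>?V. (cmod (\<phi> v))\<^sup>2)"
    unfolding N_def of_real_sum by (intro sum.cong refl) (simp only: complex_norm_square mult.commute)
  moreover have "(\<Sum>v\<in>?V. (cmod (\<phi> v))\<^sup>2) \<noteq> 0"
    using u by (subst sum_nonneg_eq_0_iff) auto
  ultimately have N0: "N \<noteq> 0" by (simp only: of_real_eq_0_iff not_False_eq_True)
  have "\<mu> * N = (\<Sum>v\<in>?V. cnj (\<phi> v) * laplacian G \<phi> v)"
    unfolding N_def by (simp add: eq sum_distrib_left mult_ac)
  also have "\<dots> = D - A"
    unfolding D_def A_def laplacian_def nb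
    by (simp add: algebra_simps sum_subtractf sum_distrib_left)
  finally have *: "\<mu> * N = D - A" .
  have "cnj \<mu> * N = \<mu> * N"
    using arg_cong[OF *, of cnj] unfolding complex_cnj_mult complex_cnj_diff A D N
    by (rule trans) (rule *[symmetric])
  with N0 have "cnj \<mu> = \<mu>" by simp
  then show ?thesis by (simp add: Reals_cnj_iff)
qed

end

theory Submission
  imports Defs "Jordan_Normal_Form.Spectral_Radius"
begin

text \<open>
  The constant functions lie in the kernel of \<open>L\<close>, so subtracting the mean from \<open>f\<close> improves the
  Rayleigh bound to \<open>\<langle>f, L f\<rangle> + \<lambda> (\<Sum> f)\<^sup>2 / n \<le> \<lambda> \<langle>f, f\<rangle>\<close> with \<open>\<lambda> = \<lambda>\<^sub>m\<^sub>a\<^sub>x\<close>. If \<open>f\<close> is supported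
  on an independent set \<open>S\<close>, then \<open>\<langle>f, L f\<rangle> = \<Sum>\<^sub>v deg v (f v)\<^sup>2\<close>, and the weights
  \<open>f v = 1 / (\<lambda> - deg v)\<close> give \<open>\<Sum>\<^sub>v\<^sub>\<in>\<^sub>S 1 / (\<lambda> - deg v) \<le> n / \<lambda>\<close>. The vertices of \<open>S\<close> of degree less
  than \<open>\<Delta>\<close> form an independent set of the derived graph; bounding their terms from below by
  \<open>1 / (\<lambda> - \<delta>)\<close> yields the claim.
\<close>

section \<open>Spectral facts about kernels on a finite set\<close>

text \<open>The first-order condition at a maximum: for small \<open>t\<close> of the sign of
  \<open>a\<close>, the linear term would outweigh the quadratic one.\<close>

lemma linear_coeff_eq_0:
  fixes a b :: real
  assumes "\<And>t. 2 * t * a + t\<^sup>2 * b \<le> 0"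
  shows "a = 0"
proof (rule ccontr)
  assume a: "a \<noteq> 0"
  \<comment> \<open>This makes both \<open>s\<close> and \<open>2 * s + b\<close> positive whatever
    the sign of \<open>b\<close>, so \<open>t = a / s\<close> violates the assumption.\<close>
  define s where "s = \<bar>b\<bar> + 1"
  have s: "s > 0" "2 * s + b > 0" unfolding s_def by auto
  have "2 * (a / s) * a + (a / s)\<^sup>2 * b = a\<^sup>2 * (2 * s + b) / s\<^sup>2"
    using s by (simp add: field_simps power2_eq_square)
  moreover have "a\<^sup>2 * (2 * s + b) / s\<^sup>2 > 0" using a s by simp
  ultimately show False using assms[of "a / s"] by simp
qed

text \<open>The Rayleigh principle: the quadratic form attains its maximum \<open>M\<close> on the
  compact unit sphere, scaling extends the bound to every \<open>f\<close>, and stationarity at the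
  maximiser \<open>x\<close> is the eigenvector equation.\<close>

lemma symmetric_kernel_max_eigenvector:
  fixes k :: "'a \<Rightarrow> 'a \<Rightarrow> real"
  assumes fin: "finite V" and ne: "V \<noteq> {}" and sym: "\<And>v w. k v w = k w v"
  obtains M x where "\<exists>v\<in>V. x v \<noteq> 0" "\<And>v. v \<in> V \<Longrightarrow> (\<Sum>w\<in>V. k v w * x w) = M * x v"
    "\<And>f. (\<Sum>v\<in>V. \<Sum>w\<in>V. f v * k v w * f w) \<le> M * (\<Sum>v\<in>V. (f v)\<^sup>2)"
proof -
  define q where "q f = (\<Sum>v\<in>V. \<Sum>w\<in>V. f v * k v w * f w)" for f
  define N where "N f = (\<Sum>v\<in>V. (f v)\<^sup>2)" for f :: "'a \<Rightarrow> real"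
  \<comment> \<open>The unit sphere inside a product of compact sets. Forcing the value 0 off
    \<open>V\<close> makes Tychonoff's theorem applicable to functions on the whole type; the
    interval excludes no unit vector, since each coordinate on \<open>V\<close> has square at most
    \<open>N\<close>.\<close>
  define K where "K = Pi\<^sub>E UNIV (\<lambda>v. if v \<in> V then {-1..1::real} else {0}) \<inter> {f. N f = 1}"
  have cont: "continuous_on A (\<lambda>f. f i)" for A :: "('a \<Rightarrow> real) set" and i
    by (rule continuous_on_subset[OF continuous_on_product_coordinates subset_UNIV])
  have "compact (Pi\<^sub>E UNIV (\<lambda>v. if v \<in> V then {-1..1::real} else {0}))"
    using compactin_PiE[of "\<lambda>_. euclidean" UNIV "\<lambda>v. if v \<in> V then {-1..1::real} else {0}"]
    by (simp add: euclidean_product_topology)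
  moreover have "closed {f. N f = 1}"
    unfolding N_def by (intro closed_Collect_eq continuous_intros cont)
  ultimately have "compact K" unfolding K_def by (rule compact_Int_closed)
  moreover obtain v0 where v0: "v0 \<in> V" using ne by blast
  have "(\<lambda>v. if v = v0 then 1 else 0) \<in> K"
    using v0 fin by (auto simp: K_def N_def if_distrib[of "\<lambda>x. x\<^sup>2"] cong: if_cong)
  then have "K \<noteq> {}" by blast
  moreover have "continuous_on K q"
    unfolding q_def by (intro continuous_intros cont)
  ultimately obtain x where x: "x \<in> K" and max: "\<And>y. y \<in> K \<Longrightarrow> q y \<le> q x"
    using continuous_attains_sup by metis
  define M where "M = q x"
  have Nx: "N x = 1" using x by (simp add: K_def)
  have bound: "q f \<le> M * N f" for f
  proof (cases "N f = 0")
    case True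
    then have "\<And>v. v \<in> V \<Longrightarrow> f v = 0"
      unfolding N_def using fin by (subst (asm) sum_nonneg_eq_0_iff) auto
    then show ?thesis using True by (simp add: q_def)
  next
    case False
    then have pos: "N f > 0"
      using sum_nonneg[of V "\<lambda>v. (f v)\<^sup>2"] by (simp add: N_def)
    define r where "r = sqrt (N f)"
    have r: "r > 0" "r\<^sup>2 = N f" using pos by (auto simp: r_def)
    define g where "g v = (if v \<in> V then f v / r else 0)" for v
    have Ng: "N g = 1"
      using pos r by (simp add: N_def g_def power_divide sum_divide_distrib[symmetric])
    have "g v \<in> {-1..1}" if "v \<in> V" for v
    proof -
      have "(g v)\<^sup>2 \<le> N g" unfolding N_def using that fin
        by (intro member_le_sum) auto
      then show ?thesis using Ng by (simp add: abs_square_le_1 abs_le_iff)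
    qed
    moreover have "g v = 0" if "v \<notin> V" for v using that by (simp add: g_def)
    ultimately have "g \<in> K" using Ng by (simp add: K_def PiE_UNIV_domain)
    then have "q g \<le> M" using max M_def by simp
    moreover have "q g = q f / r\<^sup>2"
      unfolding q_def g_def by (simp add: sum_divide_distrib power2_eq_square)
    ultimately show ?thesis using r pos by (simp add: field_simps)
  qed
  \<comment> \<open>The bilinear form of the kernel minus \<open>M\<close> times the identity: by
    \<open>bound\<close> it is negative semidefinite, and it vanishes at \<open>x\<close>.\<close>
  define c where "c f g = (\<Sum>v\<in>V. \<Sum>w\<in>V. f v * k v w * g w) - M * (\<Sum>v\<in>V. f v * g v)" for f g
  have csym: "c f g = c g f" for f g
  proof -
    have "(\<Sum>v\<in>V. \<Sum>w\<in>V. f v * k v w * g w) = (\<Sum>w\<in>V. \<Sum>v\<in>V. f v * k v w * g w)"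
      by (rule sum.swap)
    also have "\<dots> = (\<Sum>w\<in>V. \<Sum>v\<in>V. g w * k w v * f v)"
      by (intro sum.cong refl) (simp add: sym mult_ac)
    finally show ?thesis by (simp add: c_def mult_ac)
  qed
  have cq: "c f f = q f - M * N f" for f
    by (simp add: c_def q_def N_def power2_eq_square)
  have expand: "c (\<lambda>v. x v + t * h v) (\<lambda>v. x v + t * h v) = c x x + t * c x h + t * c h x + t\<^sup>2 * c h h"
    for t h
  proof -
    have "(x v + t * h v) * k v w * (x w + t * h w) = x v * k v w * x w + t * (x v * k v w * h w)
        + t * (h v * k v w * x w) + t\<^sup>2 * (h v * k v w * h w)" for v w
      by (simp add: algebra_simps power2_eq_square)
    moreover have "(x v + t * h v) * (x v + t * h v) = x v * x v + t * (x v * h v)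
        + t * (h v * x v) + t\<^sup>2 * (h v * h v)" for v
      by (simp add: algebra_simps power2_eq_square)
    ultimately show ?thesis
      unfolding c_def by (simp only: sum.distrib sum_distrib_left[symmetric]) (simp only: algebra_simps)
  qed
  \<comment> \<open>Along the line \<open>x + t * h\<close> the form stays nonpositive and is 0 at
    \<open>t = 0\<close>, so its linear coefficient \<open>2 * c h x\<close> must vanish.\<close>
  have stat: "c h x = 0" for h
  proof (rule linear_coeff_eq_0)
    fix t
    have "c x x = 0" using cq[of x] Nx by (simp add: M_def)
    then show "2 * t * c h x + t\<^sup>2 * c h h \<le> 0"
      using expand[of t h] bound[of "\<lambda>v. x v + t * h v"] csym[of x h] by (simp add: cq)
  qed
  show ?thesis
  proof
    show "\<exists>v\<in>V. x v \<noteq> 0"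
    proof (rule ccontr)
      assume "\<not> ?thesis"
      then have "N x = 0" by (simp add: N_def)
      then show False using Nx by simp
    qed
    show "(\<Sum>w\<in>V. k v w * x w) = M * x v" if "v \<in> V" for v
    proof -
      \<comment> \<open>Testing stationarity against the indicator of \<open>v\<close> reads off the
        eigenvector equation at \<open>v\<close>.\<close>
      have "(\<Sum>u\<in>V. \<Sum>w\<in>V. of_bool (u = v) * k u w * x w) = (\<Sum>w\<in>V. k v w * x w)"
        using fin that by (subst sum.remove[of _ v]) (auto intro!: sum.neutral)
      moreover have "(\<Sum>u\<in>V. of_bool (u = v) * x u) = x v"
        using fin that by (subst sum.remove[of _ v]) (auto intro!: sum.neutral)
      ultimately show ?thesis using stat[of "\<lambda>u. of_bool (u = v)"] by (simp add: c_def)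
    qed
    show "(\<Sum>v\<in>V. \<Sum>w\<in>V. f v * k v w * f w) \<le> M * (\<Sum>v\<in>V. (f v)\<^sup>2)" for f
      using bound[of f] by (simp add: q_def N_def)
  qed
qed

text \<open>Enumerating \<open>V\<close> turns the kernel into a square matrix, whose spectrum is
  finite. This finiteness is what lets the \<open>Max\<close> in \<open>lambda_max\<close> be
  compared with individual eigenvalues.\<close>

lemma finite_kernel_eigenvalues:
  fixes k :: "'a \<Rightarrow> 'a \<Rightarrow> 'b :: field"
  assumes fin: "finite V"
  shows "finite {\<mu>. \<exists>\<phi>. (\<exists>v\<in>V. \<phi> v \<noteq> 0) \<and> (\<forall>v\<in>V. (\<Sum>w\<in>V. k v w * \<phi> w) = \<mu> * \<phi> v)}"
    (is "finite ?E")
proof -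
  obtain h where h: "bij_betw h {0..<card V} V"
    using ex_bij_betw_nat_finite[OF fin] by blast
  define A where "A = Matrix.mat (card V) (card V) (\<lambda>(i, j). k (h i) (h j))"
  have A: "A \<in> carrier_mat (card V) (card V)" by (simp add: A_def)
  have "?E \<subseteq> spectrum A"
  proof safe
    fix \<mu> \<phi> v
    assume v: "v \<in> V" "\<phi> v \<noteq> 0" and eq: "\<forall>v\<in>V. (\<Sum>w\<in>V. k v w * \<phi> w) = \<mu> * \<phi> v"
    define x where "x = Matrix.vec (card V) (\<lambda>i. \<phi> (h i))"
    have "vec_index (A *\<^sub>v x) i = vec_index (\<mu> \<cdot>\<^sub>v x) i" if i: "i < card V" for i
    proof -
      have "h i \<in> V" using h i by (auto simp: bij_betw_def)
      have "vec_index (A *\<^sub>v x) i = (\<Sum>j\<in>{0..<card V}. k (h i) (h j) * \<phi> (h j))"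
        using i by (simp add: A_def x_def scalar_prod_def)
      also have "\<dots> = (\<Sum>w\<in>V. k (h i) w * \<phi> w)"
        by (rule sum.reindex_bij_betw[OF h])
      finally show ?thesis using eq \<open>h i \<in> V\<close> i by (simp add: x_def)
    qed
    then have "A *\<^sub>v x = \<mu> \<cdot>\<^sub>v x" by (intro eq_vecI) (auto simp: A_def x_def)
    moreover have "x \<noteq> 0\<^sub>v (card V)"
    proof
      assume *: "x = 0\<^sub>v (card V)"
      obtain i where "i < card V" "h i = v" using h v(1) by (force simp: bij_betw_def)
      then show False using arg_cong[OF *, of "\<lambda>y. vec_index y i"] v(2) by (simp add: x_def)
    qed
    ultimately show "\<mu> \<in> spectrum A"
      unfolding spectrum_def eigenvalue_def eigenvector_def
      by (auto intro!: exI[of _ x] simp: A_def x_def)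
  qed
  then show ?thesis using card_finite_spectrum(1)[OF A] finite_subset by blast
qed

section \<open>The Laplacian as a real quadratic form\<close>

text \<open>Kept real because the maximisation runs over real functions;
  \<open>laplacian_eq_sum\<close> links it to the complex operator.\<close>

definition laplacian_matrix :: "('a, 'b) pre_digraph \<Rightarrow> 'a \<Rightarrow> 'a \<Rightarrow> real" where
  "laplacian_matrix G v w = (if v = w then real (out_degree G v) else 0) - of_bool (v \<rightarrow>\<^bsub>G\<^esub> w)"

definition laplacian_form :: "('a, 'b) pre_digraph \<Rightarrow> ('a \<Rightarrow> real) \<Rightarrow> real" where
  "laplacian_form G f = (\<Sum>v\<in>verts G. \<Sum>w\<in>verts G. f v * laplacian_matrix G v w * f w)"

context graph
begin

lemma laplacian_eq_sum:
  assumes "v \<in> verts G"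
  shows "laplacian G \<phi> v = (\<Sum>w\<in>verts G. complex_of_real (laplacian_matrix G v w) * \<phi> w)"
proof -
  have "(\<Sum>w | v \<rightarrow>\<^bsub>G\<^esub> w. \<phi> w) = (\<Sum>w\<in>verts G. complex_of_real (of_bool (v \<rightarrow>\<^bsub>G\<^esub> w)) * \<phi> w)"
    by (rule sum.mono_neutral_cong_left) (auto simp: arcs_ends_conv)
  moreover have "(\<Sum>w\<in>verts G. (if v = w then of_nat (out_degree G v) else 0) * \<phi> w)
      = of_nat (out_degree G v) * \<phi> v"
    using assms by (simp add: if_distrib[of "\<lambda>x. x * _"] cong: if_cong)
  ultimately show ?thesis
    by (simp add: laplacian_def laplacian_matrix_def left_diff_distrib sum_subtractf
        if_distrib[of complex_of_real] cong: if_cong)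
qed

lemma laplacian_matrix_sym: "laplacian_matrix G v w = laplacian_matrix G w v"
proof -
  have "v \<rightarrow>\<^bsub>G\<^esub> w \<longleftrightarrow> w \<rightarrow>\<^bsub>G\<^esub> v"
    using sym_arcs unfolding symmetric_def by (blast dest: symD)
  then show ?thesis by (simp add: laplacian_matrix_def)
qed

text \<open>Without parallel arcs, \<open>head G\<close> is injective on the arcs leaving
  \<open>v\<close>, so counting arcs counts neighbours.\<close>

lemma out_degree_eq_card_neighbours: "out_degree G v = card {w. v \<rightarrow>\<^bsub>G\<^esub> w}"
proof -
  have "{w. v \<rightarrow>\<^bsub>G\<^esub> w} = head G ` out_arcs G v"
    by (auto simp: arcs_ends_conv arc_to_ends_def out_arcs_def)
  moreover have "inj_on (head G) (out_arcs G v)"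
    by (rule inj_onI) (auto simp: arc_to_ends_def intro: no_multi_arcs)
  ultimately show ?thesis by (simp add: out_degree_def card_image)
qed

lemma laplacian_matrix_row_sum:
  assumes "v \<in> verts G"
  shows "(\<Sum>w\<in>verts G. laplacian_matrix G v w) = 0"
proof -
  have "{w. v \<rightarrow>\<^bsub>G\<^esub> w} = {w \<in> verts G. v \<rightarrow>\<^bsub>G\<^esub> w}" by auto
  then have "(\<Sum>w\<in>verts G. of_bool (v \<rightarrow>\<^bsub>G\<^esub> w)) = real (out_degree G v)"
    by (simp add: out_degree_eq_card_neighbours of_bool_def sum.If_cases Int_def)
  then show ?thesis using assms
    by (simp add: laplacian_matrix_def sum_subtractf)
qed

text \<open>Row sums vanish, and by symmetry so do column sums, which removes every term containing
  \<open>m\<close>.\<close>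

lemma laplacian_form_shift: "laplacian_form G (\<lambda>v. f v - m) = laplacian_form G f"
proof -
  let ?k = "laplacian_matrix G"
  have row: "(\<Sum>v\<in>verts G. \<Sum>w\<in>verts G. g v * ?k v w) = 0" for g
    by (simp add: sum_distrib_left[symmetric] laplacian_matrix_row_sum)
  have "(\<Sum>v\<in>verts G. \<Sum>w\<in>verts G. ?k v w * g w) = (\<Sum>w\<in>verts G. \<Sum>v\<in>verts G. g w * ?k w v)" for g
    by (subst sum.swap) (simp add: laplacian_matrix_sym mult.commute)
  then have col: "(\<Sum>v\<in>verts G. \<Sum>w\<in>verts G. ?k v w * g w) = 0" for g
    using row by simp
  \<comment> \<open>The terms are grouped so that apart from the kernel each correction depends on
    \<open>v\<close> alone or on \<open>w\<close> alone, as \<open>row\<close> and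
    \<open>col\<close> require.\<close>
  have "(f v - m) * ?k v w * (f w - m) = f v * ?k v w * f w - m * (f v * ?k v w) + ?k v w * (m * (m - f w))"
    for v w by (simp add: algebra_simps)
  then have "laplacian_form G (\<lambda>v. f v - m) = laplacian_form G f
      - m * (\<Sum>v\<in>verts G. \<Sum>w\<in>verts G. f v * ?k v w) + (\<Sum>v\<in>verts G. \<Sum>w\<in>verts G. ?k v w * (m * (m - f w)))"
    unfolding laplacian_form_def by (simp only: sum.distrib sum_subtractf sum_distrib_left)
  then show ?thesis by (simp only: row col)
qed

text \<open>The maximum \<open>M\<close> of the form on the unit sphere is an eigenvalue, its real
  eigenvector being read as a complex one; hence \<open>M\<close> is at most
  \<open>lambda_max G\<close>.\<close>

lemma laplacian_form_le_lambda_max: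
  "laplacian_form G f \<le> lambda_max G * (\<Sum>v\<in>verts G. (f v)\<^sup>2)"
proof (cases "verts G = {}")
  case True
  then show ?thesis by (simp add: laplacian_form_def)
next
  case False
  let ?k = "laplacian_matrix G"
  obtain M x where x: "\<exists>v\<in>verts G. x v \<noteq> 0"
    and eq: "\<And>v. v \<in> verts G \<Longrightarrow> (\<Sum>w\<in>verts G. ?k v w * x w) = M * x v"
    and bound: "\<And>f. (\<Sum>v\<in>verts G. \<Sum>w\<in>verts G. f v * ?k v w * f w) \<le> M * (\<Sum>v\<in>verts G. (f v)\<^sup>2)"
    by (rule symmetric_kernel_max_eigenvector[OF finite_verts False, of ?k, OF laplacian_matrix_sym]) blast
  have "laplacian G (\<lambda>v. complex_of_real (x v)) v = complex_of_real M * complex_of_real (x v)"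
    if "v \<in> verts G" for v
    using arg_cong[OF eq[OF that], of complex_of_real] that by (simp add: laplacian_eq_sum)
  then have "laplacian_eigenvalue G (complex_of_real M)"
    unfolding laplacian_eigenvalue_def using x
    by (intro exI[of _ "\<lambda>v. complex_of_real (x v)"]) auto
  moreover have "finite {x. laplacian_eigenvalue G (complex_of_real x)}"
  proof -
    have "{\<mu>. laplacian_eigenvalue G \<mu>} = {\<mu>. \<exists>\<phi>. (\<exists>v\<in>verts G. \<phi> v \<noteq> 0) \<and>
        (\<forall>v\<in>verts G. (\<Sum>w\<in>verts G. complex_of_real (?k v w) * \<phi> w) = \<mu> * \<phi> v)}"
      by (simp add: laplacian_eigenvalue_def laplacian_eq_sum cong: ball_cong)
    then have "finite {\<mu>. laplacian_eigenvalue G \<mu>}"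
      using finite_kernel_eigenvalues[OF finite_verts, of "\<lambda>v w. complex_of_real (?k v w)"] by simp
    then show ?thesis
      using finite_vimageI[of "{\<mu>. laplacian_eigenvalue G \<mu>}" complex_of_real]
      by (simp add: vimage_def inj_of_real)
  qed
  ultimately have "M \<le> lambda_max G" unfolding lambda_max_def by (intro Max_ge) auto
  then have "M * (\<Sum>v\<in>verts G. (f v)\<^sup>2) \<le> lambda_max G * (\<Sum>v\<in>verts G. (f v)\<^sup>2)"
    by (intro mult_right_mono sum_nonneg) auto
  then show ?thesis using bound[of f] by (simp add: laplacian_form_def)
qed

lemma laplacian_form_mean_zero_bound:
  "laplacian_form G f + lambda_max G * (\<Sum>v\<in>verts G. f v)\<^sup>2 / card (verts G)
    \<le> lambda_max G * (\<Sum>v\<in>verts G. (f v)\<^sup>2)"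
proof (cases "verts G = {}")
  case True
  then show ?thesis by (simp add: laplacian_form_def)
next
  case False
  define n where "n = real (card (verts G))"
  \<comment> \<open>Subtracting the mean keeps the form and lowers the squared norm by the square of
    the sum divided by \<open>n\<close>.\<close>
  define m where "m = (\<Sum>v\<in>verts G. f v) / n"
  have n: "n > 0" using False by (simp add: n_def card_gt_0_iff)
  have "(\<Sum>v\<in>verts G. (f v - m)\<^sup>2)
      = (\<Sum>v\<in>verts G. (f v)\<^sup>2) - 2 * m * (\<Sum>v\<in>verts G. f v) + n * m\<^sup>2"
    by (simp add: power2_diff sum.distrib sum_subtractf sum_distrib_left n_def mult_ac)
  also have "\<dots> = (\<Sum>v\<in>verts G. (f v)\<^sup>2) - (\<Sum>v\<in>verts G. f v)\<^sup>2 / n"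
    using n by (simp add: m_def field_simps power2_eq_square)
  finally have "laplacian_form G f
      \<le> lambda_max G * ((\<Sum>v\<in>verts G. (f v)\<^sup>2) - (\<Sum>v\<in>verts G. f v)\<^sup>2 / n)"
    using laplacian_form_le_lambda_max[of "\<lambda>v. f v - m"] by (simp add: laplacian_form_shift)
  then show ?thesis by (simp add: n_def algebra_simps)
qed

section \<open>Weighted inequalities on independent sets\<close>

text \<open>For a function supported on \<open>S\<close>, independence kills every off-diagonal term
  of the form, so only the degrees remain.\<close>

lemma independent_set_weight_bound:
  assumes S: "independent_set G S"
  shows "lambda_max G * (\<Sum>v\<in>S. a v)\<^sup>2 / card (verts G)
    \<le> (\<Sum>v\<in>S. (a v)\<^sup>2 * (lambda_max G - out_degree G v))"
proof -
  define f where "f v = (if v \<in> S then a v else 0)" for v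
  have sub: "S \<subseteq> verts G" using S by (simp add: independent_set_def)
  then have restrict: "(\<Sum>v\<in>verts G. if v \<in> S then g v else 0) = (\<Sum>v\<in>S. g v)"
    for g :: "'a \<Rightarrow> real"
    by (simp add: sum.If_cases Int_absorb1)
  have "f v * laplacian_matrix G v w * f w = (if v = w then if v \<in> S then (a v)\<^sup>2 * out_degree G v else 0 else 0)"
    for v w
    using S no_loops adj_not_same
    by (auto simp: f_def laplacian_matrix_def independent_set_def power2_eq_square)
  then have "laplacian_form G f = (\<Sum>v\<in>S. (a v)\<^sup>2 * out_degree G v)"
    by (simp add: laplacian_form_def restrict)
  moreover have "(\<Sum>v\<in>verts G. (f v)\<^sup>2) = (\<Sum>v\<in>S. (a v)\<^sup>2)"
    using restrict[of "\<lambda>v. (a v)\<^sup>2"] by (simp add: f_def if_distrib[of "\<lambda>x. x\<^sup>2"] cong: if_cong)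
  moreover have "(\<Sum>v\<in>verts G. f v) = (\<Sum>v\<in>S. a v)"
    by (simp add: f_def restrict)
  ultimately show ?thesis
    using laplacian_form_mean_zero_bound[of f]
    by (simp add: right_diff_distrib sum_subtractf sum_distrib_left mult.commute)
qed

lemma out_degree_le_max_degree: "v \<in> verts G \<Longrightarrow> out_degree G v \<le> max_degree G"
  by (simp add: max_degree_def)

lemma min_degree_le_out_degree: "v \<in> verts G \<Longrightarrow> min_degree G \<le> out_degree G v"
  by (simp add: min_degree_def)

text \<open>A single vertex of maximal degree is an independent set, and the weight bound on it
  leaves a gap of at least \<open>lambda_max G / card (verts G)\<close>. The strict inequality keeps
  the later denominators positive.\<close>

lemma max_degree_less_lambda_max:
  assumes "arcs G \<noteq> {}"
  shows "real (max_degree G) < lambda_max G"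
proof -
  obtain e where e: "e \<in> arcs G" using assms by blast
  then have "tail G e \<in> verts G" "e \<in> out_arcs G (tail G e)" by auto
  then have "0 < out_degree G (tail G e)"
    by (auto simp: out_degree_def card_gt_0_iff)
  then have pos: "max_degree G > 0"
    using out_degree_le_max_degree \<open>tail G e \<in> verts G\<close> by fastforce
  have "max_degree G \<in> out_degree G ` verts G"
    unfolding max_degree_def using \<open>tail G e \<in> verts G\<close> by (intro Max_in) auto
  then obtain u where u: "u \<in> verts G" "out_degree G u = max_degree G" by auto
  have "lambda_max G / card (verts G) \<le> lambda_max G - max_degree G"
    using independent_set_weight_bound[of "{u}" "\<lambda>_. 1"] u by (simp add: independent_set_def)
  moreover have n: "real (card (verts G)) \<ge> 1"
    using u by (metis card_gt_0_iff empty_iff finite_verts of_nat_1 of_nat_le_iff Suc_leI One_nat_def)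
  ultimately have le: "max_degree G \<le> lambda_max G * (1 - 1 / card (verts G))"
    by (simp add: algebra_simps)
  \<comment> \<open>Otherwise the upper bound \<open>le\<close> would be nonpositive, although an
    arc forces \<Delta> > 0.\<close>
  have "lambda_max G > 0"
  proof (rule ccontr)
    assume "\<not> ?thesis"
    then have "lambda_max G * (1 - 1 / card (verts G)) \<le> 0"
      using n by (intro mult_nonpos_nonneg) auto
    then show False using le pos by simp
  qed
  moreover have "lambda_max G / card (verts G) > 0" using calculation n by simp
  ultimately show ?thesis using le by (simp add: algebra_simps)
qed

text \<open>These weights are the optimal choice by Cauchy-Schwarz. Each satisfies
  \<open>a\<^sup>2 * (lambda_max G - deg) = a\<close>, so both sides of the weight bound involve the
  same sum \<open>s\<close>, and one factor \<open>s\<close> cancels.\<close>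

lemma sum_inverse_lambda_max_minus_degree_le:
  assumes "arcs G \<noteq> {}" and S: "independent_set G S"
  shows "(\<Sum>v\<in>S. 1 / (lambda_max G - out_degree G v)) \<le> card (verts G) / lambda_max G"
proof -
  let ?l = "lambda_max G"
  define s where "s = (\<Sum>v\<in>S. 1 / (?l - out_degree G v))"
  have sub: "S \<subseteq> verts G" using S by (simp add: independent_set_def)
  have lt: "?l - out_degree G v > 0" if "v \<in> S" for v
    using that sub out_degree_le_max_degree[of v] max_degree_less_lambda_max[OF assms(1)] by force
  have "(\<Sum>v\<in>S. (1 / (?l - out_degree G v))\<^sup>2 * (?l - out_degree G v)) = s"
    unfolding s_def by (intro sum.cong refl) (use lt in \<open>force simp: power2_eq_square\<close>)
  then have *: "?l * s\<^sup>2 / card (verts G) \<le> s"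
    using independent_set_weight_bound[OF S, of "\<lambda>v. 1 / (?l - out_degree G v)"]
    by (simp add: s_def)
  have l: "?l > 0" using max_degree_less_lambda_max[OF assms(1)] by linarith
  have "verts G \<noteq> {}" using assms(1) wellformed by blast
  then have n: "real (card (verts G)) > 0" by (simp add: card_gt_0_iff)
  have "s \<ge> 0" unfolding s_def using lt by (intro sum_nonneg) (simp add: less_imp_le)
  show ?thesis
  proof (cases "s = 0")
    \<comment> \<open>Cancelling \<open>s\<close> requires \<open>s > 0\<close>; the value 0 occurs
      for empty \<open>S\<close>.\<close>
    case True
    then show ?thesis using l n s_def by simp
  next
    case False
    then have s: "s > 0" using \<open>s \<ge> 0\<close> by simp
    have "s * (?l * s) \<le> s * card (verts G)"
      using * n by (simp add: field_simps power2_eq_square)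
    then have "?l * s \<le> card (verts G)" using s by simp
    then show ?thesis using l by (simp add: s_def[symmetric] field_simps)
  qed
qed

section \<open>Passage to the derived graph and the final count\<close>

lemma finite_independent_sets: "finite {S. independent_set G S}"
  by (rule finite_subset[of _ "Pow (verts G)"]) (auto simp: independent_set_def)

text \<open>An induced subgraph has no adjacencies beyond those of \<open>G\<close>, so independence
  is inherited. For regular \<open>G\<close> the set on the left is empty.\<close>

lemma card_le_independence_number_derived_graph:
  assumes S: "independent_set G S"
  shows "card {v \<in> S. out_degree G v \<noteq> max_degree G} \<le> independence_number (derived_graph G)"
proof -
  have "finite {S. independent_set (derived_graph G) S}"
    by (rule finite_subset[of _ "Pow (verts G)"]) (auto simp: independent_set_def derived_graph_def)
  moreover have "independent_set (derived_graph G) {v \<in> S. out_degree G v \<noteq> max_degree G}"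
    using S by (auto simp: independent_set_def derived_graph_def arcs_ends_conv)
  ultimately show ?thesis
    unfolding independence_number_def by (intro Max_ge) auto
qed

end

theorem theorem1p2:
  fixes G :: "('a, 'b) pre_digraph"
  assumes "graph G"
    and "arcs G \<noteq> {}"
  shows "real (independence_number G) \<le>
    real (card (verts G)) * (1 - real (max_degree G) / lambda_max G)
    + real (independence_number (derived_graph G)) *
      ((real (max_degree G) - real (min_degree G)) / (lambda_max G - real (min_degree G)))"
proof -
  interpret graph G by fact
  have "independence_number G \<in> card ` {S. independent_set G S}"
    unfolding independence_number_def
    by (intro Max_in finite_imageI finite_independent_sets) (auto simp: independent_set_def)
  then obtain S where S: "independent_set G S" "card S = independence_number G" by auto
  have sub: "S \<subseteq> verts G" using S by (simp add: independent_set_def)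
  then have finS: "finite S" using finite_subset finite_verts by blast
  define l D d n where "l = lambda_max G" and "D = real (max_degree G)"
    and "d = real (min_degree G)" and "n = real (card (verts G))"
  define T where "T = {v \<in> S. out_degree G v \<noteq> max_degree G}"
  have Dl: "D < l" using max_degree_less_lambda_max[OF assms(2)] by (simp add: D_def l_def)
  have D0: "D \<ge> 0" by (simp add: D_def)
  obtain u where "u \<in> verts G" using assms(2) wellformed by blast
  then have dD: "d \<le> D"
    using out_degree_le_max_degree min_degree_le_out_degree by (force simp: D_def d_def)
  have TS: "T \<subseteq> S" by (auto simp: T_def)
  have "(\<Sum>v\<in>S. 1 / (l - out_degree G v))
      = (\<Sum>v\<in>S - T. 1 / (l - out_degree G v)) + (\<Sum>v\<in>T. 1 / (l - out_degree G v))"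
    using TS finS by (rule sum.subset_diff)
  \<comment> \<open>Outside \<open>T\<close> every degree equals \<Delta>, so these terms are
    constant and are counted exactly; only the terms in \<open>T\<close> are estimated.\<close>
  also have "(\<Sum>v\<in>S - T. 1 / (l - out_degree G v)) = (\<Sum>v\<in>S - T. 1 / (l - D))"
    by (intro sum.cong refl) (auto simp: T_def D_def)
  also have "\<dots> = (real (card S) - card T) / (l - D)"
    using TS finS by (simp add: card_Diff_subset finite_subset card_mono of_nat_diff)
  finally have split: "(\<Sum>v\<in>S. 1 / (l - out_degree G v))
      = (real (card S) - card T) / (l - D) + (\<Sum>v\<in>T. 1 / (l - out_degree G v))" .
  have "(\<Sum>v\<in>T. 1 / (l - d)) \<le> (\<Sum>v\<in>T. 1 / (l - out_degree G v))"
  proof (rule sum_mono)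
    fix v assume "v \<in> T"
    then have v: "v \<in> verts G" using TS sub by blast
    have "d \<le> out_degree G v" "out_degree G v \<le> D"
      using v out_degree_le_max_degree min_degree_le_out_degree by (simp_all add: d_def D_def)
    then show "1 / (l - d) \<le> 1 / (l - out_degree G v)"
      using Dl by (intro divide_left_mono) auto
  qed
  then have "(real (card S) - card T) / (l - D) + card T / (l - d) \<le> n / l"
    using sum_inverse_lambda_max_minus_degree_le[OF assms(2) S(1)] split
    by (simp add: l_def n_def)
  \<comment> \<open>Multiplying by \<open>l - D\<close> isolates \<open>card S\<close>; each vertex
    of \<open>T\<close> then costs \<open>1 - (l - D) / (l - d)\<close>, which is the factor
    \<open>(D - d) / (l - d)\<close> of the claim.\<close>
  then have "((real (card S) - card T) / (l - D) + card T / (l - d)) * (l - D) \<le> n / l * (l - D)"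
    using Dl by (intro mult_right_mono) auto
  moreover have "((real (card S) - card T) / (l - D) + card T / (l - d)) * (l - D)
      = card S - card T * ((D - d) / (l - d))"
  proof -
    have "(D - d) / (l - d) = 1 - (l - D) / (l - d)"
      using Dl dD by (simp add: divide_simps)
    moreover have "((x - y) / p + y / q) * p = x - y * (1 - p / q)" if "p \<noteq> 0"
      for x y p q :: real
      using that by (simp add: distrib_right right_diff_distrib)
    moreover have "l - D \<noteq> 0" using Dl by simp
    ultimately show ?thesis by (simp only:)
  qed
  moreover have "n / l * (l - D) = n * (1 - D / l)"
    using Dl D0 by (simp add: field_simps)
  \<comment> \<open>This factor is nonnegative because \<open>d \<le> D < l\<close>, so
    \<open>card T\<close> may be replaced by the larger \<alpha>'.\<close>
  moreover have "card T * ((D - d) / (l - d))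
      \<le> independence_number (derived_graph G) * ((D - d) / (l - d))"
    using card_le_independence_number_derived_graph[OF S(1)] Dl dD
    by (intro mult_right_mono) (auto simp: T_def)
  ultimately show ?thesis
    unfolding S(2) l_def D_def d_def n_def by linarith
qed

end
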